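(* Let $\mathcal H$ be a complex Hilbert space, $A$ a positive bounded operator on $\mathcal H$, and let $C_1,C_2,D_1,D_2,X_1,X_2\in\mathbb B_A(\mathcal H)$. Then $$r_A(C_1X_1D_1+C_2X_2D_2)\le\min(\alpha_1,\alpha_2),$$ where $$\alpha_1=\tfrac12\Big(\|X_1D_1C_1\|_A+\|D_2C_2X_2\|_A+\sqrt{(\|X_1D_1C_1\|_A-\|D_2C_2X_2\|_A)^2+4\|X_1D_1C_2X_2\|_A\|D_2C_1\|_A}\Big)$$ and $$\alpha_2=\tfrac12\Big(\|D_1C_1X_1\|_A+\|X_2D_2C_2\|_A+\sqrt{(\|D_1C_1X_1\|_A-\|X_2D_2C_2\|_A)^2+4\|X_2D_2C_1X_1\|_A\|D_1C_2\|_A}\Big).$$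
   Context: For a positive bounded operator $A$ on $\mathcal H$: $\|z\|_A=\langle Az,z\rangle^{1/2}$ and $\|S\|_A=\sup\{\|Sz\|_A:\|z\|_A=1\}$. $\mathbb B_A(\mathcal H)$ is the set of bounded operators $S$ on $\mathcal H$ admitting an $A$-adjoint, i.e. a bounded $R$ with $AR=S^*A$. The $A$-spectral radius of $S\in\mathbb B_A(\mathcal H)$ is $r_A(S)=\lim_{n\to\infty}\|S^n\|_A^{1/n}$. *)

theory Defs
  imports "HOL-Analysis.Analysis"
begin

text \<open>
  Complex Hilbert spaces. The inner product is linear in its first argument. The underlying
  real Hilbert space carries the real inner product \<open>Re \<langle>x, y\<rangle>\<close>, so that positive definiteness of
  \<open>cinner\<close> and \<open>norm x = sqrt (Re \<langle>x, x\<rangle>)\<close> are inherited from the class \<open>real_inner\<close>.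
\<close>

class complex_inner = real_inner +
  fixes scaleC :: "complex \<Rightarrow> 'a \<Rightarrow> 'a"  (infixr \<open>*\<^sub>C\<close> 75)
    and cinner :: "'a \<Rightarrow> 'a \<Rightarrow> complex"
  assumes scaleC_add_right: "c *\<^sub>C (x + y) = c *\<^sub>C x + c *\<^sub>C y"
    and scaleC_add_left: "(c + d) *\<^sub>C x = c *\<^sub>C x + d *\<^sub>C x"
    and scaleC_scaleC: "c *\<^sub>C d *\<^sub>C x = (c * d) *\<^sub>C x"
    and scaleC_of_real: "complex_of_real r *\<^sub>C x = r *\<^sub>R x"
    and cinner_commute: "cinner y x = cnj (cinner x y)"
    and cinner_add_left: "cinner (x + y) z = cinner x z + cinner y z"
    and cinner_scaleC_left: "cinner (c *\<^sub>C x) y = c * cinner x y"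
    and inner_eq_Re_cinner: "inner x y = Re (cinner x y)"

class chilbert_space = complex_inner + banach

definition bounded_clinear :: "('h::complex_inner \<Rightarrow> 'h) \<Rightarrow> bool" where
  "bounded_clinear T \<longleftrightarrow> bounded_linear T \<and> (\<forall>c x. T (c *\<^sub>C x) = c *\<^sub>C T x)"

definition positive_op :: "('h::complex_inner \<Rightarrow> 'h) \<Rightarrow> bool" where
  "positive_op A \<longleftrightarrow> bounded_clinear A \<and> (\<forall>x. cinner (A x) x \<in> \<real>\<^sub>\<ge>\<^sub>0)"

text \<open>
  The Hilbert space adjoint, in the style of \<open>adjoint\<close> for real inner products; it is uniquely
  determined whenever it exists, in particular for every bounded operator on a Hilbert space.
\<close>

definition cadjoint :: "('h::complex_inner \<Rightarrow> 'h) \<Rightarrow> 'h \<Rightarrow> 'h" where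
  "cadjoint T = (SOME T'. \<forall>x y. cinner (T x) y = cinner x (T' y))"

definition B_A :: "('h::chilbert_space \<Rightarrow> 'h) \<Rightarrow> ('h \<Rightarrow> 'h) set" where
  "B_A A = {S. bounded_clinear S \<and> (\<exists>R. bounded_clinear R \<and> A \<circ> R = cadjoint S \<circ> A)}"

definition A_norm :: "('h::complex_inner \<Rightarrow> 'h) \<Rightarrow> 'h \<Rightarrow> real" where
  "A_norm A z = sqrt (Re (cinner (A z) z))"

text \<open>
  For \<open>A = 0\<close> there is no vector with \<open>A_norm A z = 1\<close>; the empty supremum (of nonnegative
  quantities) is then \<open>0\<close>, whereas the supremum of the empty set of reals is unspecified.
  The set is bounded above for all \<open>S \<in> B_A A\<close> when \<open>A\<close> is positive.
\<close>

definition A_opnorm :: "('h::complex_inner \<Rightarrow> 'h) \<Rightarrow> ('h \<Rightarrow> 'h) \<Rightarrow> real" where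
  "A_opnorm A S =
    (if {z. A_norm A z = 1} = {} then 0 else (SUP z \<in> {z. A_norm A z = 1}. A_norm A (S z)))"

definition A_spectral_radius :: "('h::complex_inner \<Rightarrow> 'h) \<Rightarrow> ('h \<Rightarrow> 'h) \<Rightarrow> real" where
  "A_spectral_radius A S = lim (\<lambda>n. root n (A_opnorm A (S ^^ n)))"

end

theory Submission
  imports Defs
begin

text \<open>
  Both bounds are instances of one estimate for a sum \<open>T = E\<^sub>1 F\<^sub>1 + E\<^sub>2 F\<^sub>2\<close>. Since
  \<open>F\<^sub>i T = F\<^sub>i E\<^sub>1 F\<^sub>1 + F\<^sub>i E\<^sub>2 F\<^sub>2\<close>, the pair \<open>(\<parallel>F\<^sub>1 T\<^sup>n z\<parallel>\<^sub>A, \<parallel>F\<^sub>2 T\<^sup>n z\<parallel>\<^sub>A)\<close> grows at most like the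
  powers of the nonnegative matrix \<open>M\<close> with entries \<open>\<parallel>F\<^sub>i E\<^sub>j\<parallel>\<^sub>A\<close>. The asserted bound is the Perron root
  of \<open>M\<close>, and for every \<open>t\<close> above it there is a positive vector \<open>w\<close> with \<open>M w \<le> t w\<close>, whence
  \<open>\<parallel>T\<^sup>n\<parallel>\<^sub>A = O(t\<^sup>n)\<close>. Members of \<open>B_A A\<close> are bounded for the seminorm of \<open>A\<close> by Lax's iteration of
  the Cauchy-Schwarz inequality; the limit defining the spectral radius exists by Fekete's lemma.
\<close>

section \<open>Submultiplicative sequences\<close>

text \<open>Split \<open>n\<close> into blocks of length \<open>m\<close> and a remainder below
  \<open>m\<close>: each block costs a factor \<open>t ^ m\<close>, and the finitely many remainders
  are absorbed by \<open>K\<close>.\<close>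

lemma submultiplicative_power_bound:
  fixes a :: "nat \<Rightarrow> real"
  assumes nonneg: "\<And>n. 0 \<le> a n" and sub: "\<And>m n. a (m + n) \<le> a m * a n"
    and "0 < m" "0 < t" and am: "a m \<le> t ^ m"
  obtains K where "0 < K" "\<And>n. a n \<le> K * t ^ n"
proof -
  define K where "K = 1 + (\<Sum>r<m. a r / t ^ r)"
  have K1: "K \<ge> 1" unfolding K_def using nonneg \<open>0 < t\<close> by (simp add: sum_nonneg)
  have small: "a r \<le> K * t ^ r" if "r < m" for r
  proof -
    have "a r / t ^ r \<le> (\<Sum>r<m. a r / t ^ r)"
      using that nonneg \<open>0 < t\<close> by (intro member_le_sum) auto
    then have "a r / t ^ r \<le> K" unfolding K_def by simp
    then show ?thesis using \<open>0 < t\<close> by (simp add: divide_le_eq)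
  qed
  have "a n \<le> K * t ^ n" for n
  proof (induction n rule: less_induct)
    case (less n)
    show ?case
    proof (cases "n < m")
      case False
      then have "a n \<le> a m * a (n - m)" using sub[of m "n - m"] by simp
      also have "\<dots> \<le> t ^ m * (K * t ^ (n - m))"
        using False \<open>0 < m\<close> \<open>0 < t\<close> nonneg am less.IH[of "n - m"] by (intro mult_mono) auto
      also have "\<dots> = K * t ^ n" using False by (simp add: power_add[symmetric])
      finally show ?thesis .
    qed (rule small)
  qed
  with K1 show thesis by (intro that[of K]) auto
qed

text \<open>The limit is the infimum over \<open>n \<ge> 1\<close>; index 0 would spoil it, since
  \<open>root 0\<close> is constantly 0.\<close>

lemma submultiplicative_root_convergent:
  fixes a :: "nat \<Rightarrow> real"
  assumes nonneg: "\<And>n. 0 \<le> a n" and sub: "\<And>m n. a (m + n) \<le> a m * a n"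
  shows "convergent (\<lambda>n. root n (a n))"
proof -
  define L where "L = (INF n\<in>{1..}. root n (a n))"
  have bdd: "bdd_below ((\<lambda>n. root n (a n)) ` {1..})"
    using nonneg by (intro bdd_belowI2[of _ 0]) (simp add: real_root_ge_zero)
  have L_le: "L \<le> root n (a n)" if "n \<ge> 1" for n
    unfolding L_def using that bdd by (intro cINF_lower) auto
  have L0: "0 \<le> L" unfolding L_def
    using nonneg by (intro cINF_greatest) (auto simp: real_root_ge_zero)
  have "(\<lambda>n. root n (a n)) \<longlonglongrightarrow> L"
  proof (rule order_tendstoI)
    fix x assume "x < L"
    then show "eventually (\<lambda>n. x < root n (a n)) sequentially"
      using L_le by (intro eventually_sequentiallyI[of 1]) (meson less_le_trans)
  next
    fix x assume "L < x"
    \<comment> \<open>The gap between \<open>t\<close> and \<open>x\<close> makes room for the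
      factor \<open>root n K\<close>, which tends to 1.\<close>
    define t where "t = (L + x) / 2"
    have t: "L < t" "t < x" "0 < t" using \<open>L < x\<close> L0 by (auto simp: t_def)
    obtain m where m: "m \<ge> 1" "root m (a m) < t"
      using t(1) bdd unfolding L_def by (subst (asm) cINF_less_iff) auto
    have "a m = root m (a m) ^ m" using m nonneg by simp
    also have "\<dots> \<le> t ^ m" using m nonneg by (intro power_mono) (auto simp: real_root_ge_zero)
    finally obtain K where K: "0 < K" "\<And>n. a n \<le> K * t ^ n"
      using submultiplicative_power_bound[OF nonneg sub, of m t] m t by auto
    have "(\<lambda>n. root n K * t) \<longlonglongrightarrow> 1 * t"
      by (intro tendsto_mult LIMSEQ_root_const K tendsto_const)
    then have "eventually (\<lambda>n. root n K * t < x) sequentially"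
      using t by (intro order_tendstoD) auto
    then show "eventually (\<lambda>n. root n (a n) < x) sequentially"
      using eventually_gt_at_top[of 0]
    proof eventually_elim
      case (elim n)
      have "root n (a n) \<le> root n (K * t ^ n)" using K elim by simp
      also have "\<dots> = root n K * t"
        using elim t by (simp add: real_root_mult real_root_power_cancel)
      finally show ?case using elim by simp
    qed
  qed
  then show ?thesis by (auto simp: convergent_def)
qed

text \<open>Turns a growth rate into a bound on the spectral radius: \<open>K\<close> disappears
  because \<open>root n K\<close> tends to 1.\<close>

lemma LIMSEQ_root_le:
  fixes a :: "nat \<Rightarrow> real"
  assumes lim: "(\<lambda>n. root n (a n)) \<longlonglongrightarrow> l" and "0 < K" "0 < t" and le: "\<And>n. a n \<le> K * t ^ n"
  shows "l \<le> t"
proof -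
  have "(\<lambda>n. root n K * t) \<longlonglongrightarrow> 1 * t"
    by (intro tendsto_mult LIMSEQ_root_const \<open>0 < K\<close> tendsto_const)
  moreover have "root n (a n) \<le> root n K * t" if "n \<ge> 1" for n
  proof -
    have "root n (a n) \<le> root n (K * t ^ n)" using le that by simp
    also have "\<dots> = root n K * t"
      using that \<open>0 < t\<close> by (simp add: real_root_mult real_root_power_cancel)
    finally show ?thesis .
  qed
  ultimately show ?thesis using lim by (intro LIMSEQ_le[OF lim, of _ t]) auto
qed

section \<open>Riesz representation and adjoints\<close>

text \<open>First-order condition: the quadratic attains its minimum 0 at \<open>s = 0\<close>, so
  its derivative \<open>2 * b\<close> there vanishes.\<close>

lemma quadratic_nonneg_imp_linear_coeff_zero:
  fixes b c :: real
  assumes "\<And>s. 0 \<le> 2 * s * b + s\<^sup>2 * c"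
  shows "b = 0"
proof (rule ccontr)
  assume "b \<noteq> 0"
  have "0 \<le> c" using assms[of 1] assms[of "-1"] by simp
  \<comment> \<open>The vertex is at \<open>- b / c\<close>; the added 1 keeps the choice valid for
    \<open>c = 0\<close>.\<close>
  define s where "s = - b / (c + 1)"
  have b: "b = - (s * (c + 1))" and "s \<noteq> 0"
    using \<open>0 \<le> c\<close> \<open>b \<noteq> 0\<close> by (auto simp: s_def)
  have "2 * s * b + s\<^sup>2 * c = - (s\<^sup>2 * (c + 2))"
    unfolding b by (simp add: power2_eq_square algebra_simps)
  also have "\<dots> < 0" using \<open>0 \<le> c\<close> \<open>s \<noteq> 0\<close> by simp
  finally show False using assms[of s] by simp
qed

text \<open>The representing vector is the minimizer of \<open>\<parallel>x\<parallel>\<^sup>2 - 2 f x\<close>; the parallelogram law makes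
  minimizing sequences Cauchy.\<close>

lemma riesz_representation:
  fixes f :: "'a::{real_inner, banach} \<Rightarrow> real"
  assumes f: "bounded_linear f"
  shows "\<exists>y. \<forall>x. f x = inner x y"
proof -
  interpret bounded_linear f by (rule f)
  define J where "J = (\<lambda>x. inner x x - 2 * f x)"
  obtain B where B: "\<And>x. norm (f x) \<le> norm x * B" using bounded by blast
  \<comment> \<open>Completing the square: \<open>J x\<close> is at least
    \<open>(norm x - B)\<^sup>2 - B\<^sup>2\<close>.\<close>
  have J_ge: "- (B\<^sup>2) \<le> J x" for x
  proof -
    have "f x \<le> norm x * B" using B[of x] by simp
    moreover have "0 \<le> (norm x - B)\<^sup>2" by simp
    ultimately show ?thesis
      unfolding J_def by (simp add: power2_norm_eq_inner[symmetric] power2_diff)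
  qed
  define m where "m = (INF x. J x)"
  have bdd: "bdd_below (range J)" using J_ge by (intro bdd_belowI2)
  have m_le: "m \<le> J x" for x unfolding m_def using bdd by (intro cINF_lower) auto
  have "\<exists>x. J x < m + 1 / real (Suc n)" for n
    using bdd cINF_less_iff[of UNIV J "m + 1 / real (Suc n)"] by (simp add: m_def)
  then obtain X where X: "\<And>n. J (X n) < m + 1 / real (Suc n)" by metis
  have par: "inner (x - y) (x - y) = 2 * J x + 2 * J y - 4 * J ((1/2) *\<^sub>R (x + y))" for x y
    unfolding J_def by (simp add: scaleR add algebra_simps inner_commute)
  \<comment> \<open>At the midpoint \<open>J\<close> is at least \<open>m\<close>, so in
    \<open>par\<close> only the excesses of \<open>J (X i)\<close> and \<open>J (X j)\<close> over
    \<open>m\<close> survive.\<close>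
  have dist: "(norm (X i - X j))\<^sup>2 \<le> 4 / real (Suc N)" if "i \<ge> N" "j \<ge> N" for i j N
  proof -
    have "1 / real (Suc i) \<le> 1 / real (Suc N)" "1 / real (Suc j) \<le> 1 / real (Suc N)"
      using that by (auto simp: frac_le)
    then show ?thesis
      using X[of i] X[of j] m_le[of "(1/2) *\<^sub>R (X i + X j)"] par[of "X i" "X j"]
      by (simp add: power2_norm_eq_inner)
  qed
  have "Cauchy X"
  proof (rule CauchyI)
    fix e :: real assume e: "0 < e"
    obtain N where N: "1 / real (Suc N) < e\<^sup>2 / 4"
      using e by (metis nat_approx_posE zero_less_divide_iff zero_less_numeral zero_less_power)
    have "norm (X i - X j) < e" if "i \<ge> N" "j \<ge> N" for i j
    proof -
      have "(norm (X i - X j))\<^sup>2 < e\<^sup>2" using dist[OF that] N by simp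
      then show ?thesis using e by (simp add: power_less_imp_less_base)
    qed
    then show "\<exists>M. \<forall>i\<ge>M. \<forall>j\<ge>M. norm (X i - X j) < e" by blast
  qed
  then obtain y where y: "X \<longlonglongrightarrow> y" using Cauchy_convergent_iff convergent_def by blast
  have "(\<lambda>n. J (X n)) \<longlonglongrightarrow> J y"
    unfolding J_def by (intro tendsto_intros y tendsto)
  moreover have "(\<lambda>n. m + 1 / real (Suc n)) \<longlonglongrightarrow> m + 0"
    by (intro tendsto_intros LIMSEQ_Suc[OF lim_1_over_n])
  ultimately have Jy: "J y \<le> m"
    using X by (intro LIMSEQ_le[of "\<lambda>n. J (X n)" _ "\<lambda>n. m + 1 / real (Suc n)"])
      (auto intro: less_imp_le)
  have "inner x y - f x = 0" for x
  proof (rule quadratic_nonneg_imp_linear_coeff_zero[where c = "inner x x"])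
    fix s :: real
    have "J y \<le> J (y + s *\<^sub>R x)" using Jy m_le order_trans by blast
    then show "0 \<le> 2 * s * (inner x y - f x) + s\<^sup>2 * inner x x"
      unfolding J_def
      by (simp add: add scaleR algebra_simps inner_commute power2_eq_square)
  qed
  then have "\<forall>x. f x = inner x y" by simp
  then show ?thesis by blast
qed

text \<open>Upgrades identities of the real inner product to \<open>cinner\<close>: the imaginary
  part is a real inner product at a rotated vector.\<close>

lemma cinner_imaginary: "inner (\<i> *\<^sub>C x) y = - Im (cinner x y)"
  by (simp add: inner_eq_Re_cinner cinner_scaleC_left)

text \<open>Riesz for the real inner product gives a real adjoint; complex linearity of
  \<open>T\<close> makes it a complex one, so the choice in \<open>cadjoint\<close> has a
  witness.\<close>

lemma cadjoint_cinner:
  fixes T :: "'h::chilbert_space \<Rightarrow> 'h"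
  assumes T: "bounded_clinear T"
  shows "cinner (T x) y = cinner x (cadjoint T y)"
proof -
  have blin: "bounded_linear T" and lin: "\<And>c x. T (c *\<^sub>C x) = c *\<^sub>C T x"
    using T by (auto simp: bounded_clinear_def)
  have "\<exists>z. \<forall>x. inner (T x) y = inner x z" for y
    using blin by (intro riesz_representation bounded_linear_compose[OF bounded_linear_inner_left])
  then obtain T' where T': "\<And>x y. inner (T x) y = inner x (T' y)" by metis
  have "cinner (T x) y = cinner x (T' y)" for x y
  proof (rule complex_eqI)
    show "Re (cinner (T x) y) = Re (cinner x (T' y))"
      using T'[of x y] by (simp add: inner_eq_Re_cinner)
    show "Im (cinner (T x) y) = Im (cinner x (T' y))"
      using T'[of "\<i> *\<^sub>C x" y] by (simp add: lin cinner_imaginary)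
  qed
  then have "\<exists>T'. \<forall>x y. cinner (T x) y = cinner x (T' y)" by blast
  then have "\<forall>x y. cinner (T x) y = cinner x (cadjoint T y)"
    unfolding cadjoint_def by (rule someI_ex)
  then show ?thesis by blast
qed

section \<open>The seminorm of a positive operator\<close>

locale positive_operator =
  fixes A :: "'h::complex_inner \<Rightarrow> 'h"
  assumes positive: "positive_op A"
begin

lemma bounded_linear: "bounded_linear A"
  using positive by (simp add: positive_op_def bounded_clinear_def)

sublocale bounded_linear A by (rule bounded_linear)

lemma inner_nonneg: "0 \<le> inner (A x) x"
  using positive by (simp add: positive_op_def inner_eq_Re_cinner complex_nonneg_Reals_iff)

text \<open>Reality of \<open>\<langle>A (x + \<i> y), x + \<i> y\<rangle>\<close> is what makes the form symmetric.\<close>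

lemma inner_sym: "inner (A x) y = inner (A y) x"
proof -
  have A_i: "A (\<i> *\<^sub>C y) = \<i> *\<^sub>C A y"
    using positive by (auto simp: positive_op_def bounded_clinear_def)
  have real: "Im (cinner (A z) z) = 0" for z
    using positive by (auto simp: positive_op_def complex_nonneg_Reals_iff)
  have add_right: "cinner a (b + c) = cinner a b + cinner a c" for a b c :: 'h
    by (metis cinner_add_left cinner_commute complex_cnj_add)
  have scale_right: "cinner a (d *\<^sub>C b) = cnj d * cinner a b" for a b :: 'h and d
    by (metis cinner_scaleC_left cinner_commute complex_cnj_mult)
  have "Im (cinner (A (x + \<i> *\<^sub>C y)) (x + \<i> *\<^sub>C y)) = 0" by (rule real)
  then show ?thesis
    using real[of x] real[of y]
    by (simp add: add A_i cinner_add_left add_right cinner_scaleC_left scale_right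
        inner_eq_Re_cinner)
qed

lemma A_norm_eq: "A_norm A x = sqrt (inner (A x) x)"
  by (simp add: A_norm_def inner_eq_Re_cinner)

lemma A_norm_nonneg [simp]: "0 \<le> A_norm A x"
  by (simp add: A_norm_eq inner_nonneg)

lemma A_norm_power2: "(A_norm A x)\<^sup>2 = inner (A x) x"
  by (simp add: A_norm_eq inner_nonneg)

lemma A_norm_scaleR: "A_norm A (r *\<^sub>R x) = \<bar>r\<bar> * A_norm A x"
  by (simp add: A_norm_eq scaleR real_sqrt_mult mult.assoc[symmetric])

text \<open>The form is only semidefinite, so vectors \<open>y\<close> of seminorm 0 are treated
  apart; otherwise \<open>expand\<close> is evaluated at its minimizing \<open>s\<close>.\<close>

lemma cauchy_schwarz: "\<bar>inner (A x) y\<bar> \<le> A_norm A x * A_norm A y"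
proof -
  have expand: "0 \<le> inner (A x) x - 2 * s * inner (A x) y + s\<^sup>2 * inner (A y) y" for s
    using inner_nonneg[of "x - s *\<^sub>R y"] inner_sym[of x y]
    by (simp add: diff scaleR inner_diff_left inner_diff_right algebra_simps power2_eq_square)
  have "(inner (A x) y)\<^sup>2 \<le> inner (A x) x * inner (A y) y"
  proof (cases "inner (A y) y = 0")
    case True
    have "inner (A x) y = 0"
    proof (rule ccontr)
      assume ne: "inner (A x) y \<noteq> 0"
      \<comment> \<open>Here \<open>expand\<close> is affine in \<open>s\<close>, and this
        \<open>s\<close> makes its right-hand side -1.\<close>
      show False
        using expand[of "(inner (A x) x + 1) / (2 * inner (A x) y)"] True ne by simp
    qed
    then show ?thesis using True by simp
  next
    case False
    then have pos: "0 < inner (A y) y" using inner_nonneg[of y] by simp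
    define s where "s = inner (A x) y / inner (A y) y"
    have "s\<^sup>2 * inner (A y) y = s * inner (A x) y"
      using pos by (simp add: s_def power2_eq_square)
    then have "s * inner (A x) y \<le> inner (A x) x" using expand[of s] by simp
    then show ?thesis using pos by (simp add: s_def field_simps power2_eq_square)
  qed
  then have "(inner (A x) y)\<^sup>2 \<le> (A_norm A x * A_norm A y)\<^sup>2"
    by (simp add: power_mult_distrib A_norm_power2)
  then show ?thesis by (metis A_norm_nonneg abs_le_square_iff abs_of_nonneg mult_nonneg_nonneg)
qed

lemma A_norm_triangle: "A_norm A (x + y) \<le> A_norm A x + A_norm A y"
proof (rule power2_le_imp_le)
  have "(A_norm A (x + y))\<^sup>2 = (A_norm A x)\<^sup>2 + 2 * inner (A x) y + (A_norm A y)\<^sup>2"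
    using inner_sym[of x y] by (simp add: A_norm_power2 add inner_add_left inner_add_right)
  also have "\<dots> \<le> (A_norm A x + A_norm A y)\<^sup>2"
    using cauchy_schwarz[of x y] by (simp add: power2_sum)
  finally show "(A_norm A (x + y))\<^sup>2 \<le> (A_norm A x + A_norm A y)\<^sup>2" .
qed simp

lemma A_norm_le_norm: obtains M where "0 < M" "\<And>x. A_norm A x \<le> M * norm x"
proof -
  obtain K where K: "0 < K" "\<And>x. norm (A x) \<le> norm x * K" using pos_bounded by blast
  have "A_norm A x \<le> sqrt K * norm x" for x
  proof -
    have "inner (A x) x \<le> norm (A x) * norm x" by (rule norm_cauchy_schwarz)
    also have "\<dots> \<le> K * (norm x)\<^sup>2"
      using mult_right_mono[OF K(2)[of x], of "norm x"] by (simp add: power2_eq_square ac_simps)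
    finally have "A_norm A x \<le> sqrt (K * (norm x)\<^sup>2)"
      unfolding A_norm_eq by (rule real_sqrt_le_mono)
    then show ?thesis by (simp add: real_sqrt_mult)
  qed
  then show thesis using K by (intro that[of "sqrt K"]) auto
qed

section \<open>Operators bounded for the seminorm\<close>

text \<open>The bound includes vectors of seminorm 0, which \<open>A_opnorm\<close> never sees; such
  operators therefore preserve the null space of the seminorm.\<close>

definition A_bounded :: "('h \<Rightarrow> 'h) \<Rightarrow> bool" where
  "A_bounded S \<longleftrightarrow> linear S \<and> (\<exists>M\<ge>0. \<forall>z. A_norm A (S z) \<le> M * A_norm A z)"

lemma A_bounded_id: "A_bounded id"
  unfolding A_bounded_def by (auto intro!: exI[of _ 1] linear_id)

lemma A_bounded_compose:
  assumes "A_bounded S" "A_bounded T"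
  shows "A_bounded (S \<circ> T)"
proof -
  obtain M N where M: "0 \<le> M" "\<And>z. A_norm A (S z) \<le> M * A_norm A z"
    and N: "0 \<le> N" "\<And>z. A_norm A (T z) \<le> N * A_norm A z"
    using assms by (auto simp: A_bounded_def)
  have "A_norm A (S (T z)) \<le> M * N * A_norm A z" for z
    using order_trans[OF M(2)[of "T z"] mult_left_mono[OF N(2)[of z] M(1)]]
    by (simp add: mult.assoc)
  then show ?thesis
    using assms M N unfolding A_bounded_def by (auto intro!: linear_compose exI[of _ "M * N"])
qed

lemma A_bounded_add:
  assumes "A_bounded S" "A_bounded T"
  shows "A_bounded (\<lambda>x. S x + T x)"
proof -
  obtain M N where M: "0 \<le> M" "\<And>z. A_norm A (S z) \<le> M * A_norm A z"
    and N: "0 \<le> N" "\<And>z. A_norm A (T z) \<le> N * A_norm A z"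
    using assms by (auto simp: A_bounded_def)
  have "A_norm A (S z + T z) \<le> (M + N) * A_norm A z" for z
    using order_trans[OF A_norm_triangle add_mono[OF M(2)[of z] N(2)[of z]]]
    by (simp add: distrib_right)
  then show ?thesis
    using assms M N unfolding A_bounded_def
    by (auto intro!: linear_compose_add exI[of _ "M + N"])
qed

lemma A_bounded_funpow: "A_bounded S \<Longrightarrow> A_bounded (S ^^ n)"
  by (induction n) (auto intro: A_bounded_id A_bounded_compose)

lemma A_norm_le_A_opnorm:
  assumes "A_bounded S"
  shows "A_norm A (S z) \<le> A_opnorm A S * A_norm A z"
proof -
  obtain M where lin: "linear S" and M: "0 \<le> M" "\<And>z. A_norm A (S z) \<le> M * A_norm A z"
    using assms by (auto simp: A_bounded_def)
  show ?thesis
  proof (cases "A_norm A z = 0")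
    case True
    then show ?thesis using M(2)[of z] by simp
  next
    case False
    define w where "w = (1 / A_norm A z) *\<^sub>R z"
    have w: "A_norm A w = 1" using False by (simp add: w_def A_norm_scaleR)
    have "bdd_above ((\<lambda>z. A_norm A (S z)) ` {z. A_norm A z = 1})"
      using M(2) by (intro bdd_aboveI2[of _ _ M]) (metis mem_Collect_eq mult.right_neutral)
    then have "A_norm A (S w) \<le> A_opnorm A S"
      using w by (auto simp: A_opnorm_def intro!: cSUP_upper)
    moreover have "A_norm A (S w) = A_norm A (S z) / A_norm A z"
      by (simp add: w_def linear_scale[OF lin] A_norm_scaleR)
    ultimately show ?thesis
      using False A_norm_nonneg[of z] by (simp add: divide_le_eq split: if_splits)
  qed
qed

text \<open>The condition \<open>0 \<le> K\<close> matters when no vector has seminorm 1 and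
  \<open>A_opnorm\<close> takes its default value 0.\<close>

lemma A_opnorm_le:
  assumes "0 \<le> K" "\<And>z. A_norm A (S z) \<le> K * A_norm A z"
  shows "A_opnorm A S \<le> K"
  using assms unfolding A_opnorm_def
  by (auto intro!: cSUP_least) (metis mult.right_neutral)

lemma A_opnorm_nonneg:
  assumes "A_bounded S"
  shows "0 \<le> A_opnorm A S"
proof (cases "{z. A_norm A z = 1} = {}")
  case False
  then obtain w where "A_norm A w = 1" by auto
  then show ?thesis using order_trans[OF A_norm_nonneg A_norm_le_A_opnorm[OF assms, of w]] by simp
qed (simp add: A_opnorm_def)

lemma A_opnorm_compose_le:
  assumes "A_bounded S" "A_bounded T"
  shows "A_opnorm A (S \<circ> T) \<le> A_opnorm A S * A_opnorm A T"
proof (rule A_opnorm_le)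
  fix z
  have "A_norm A (S (T z)) \<le> A_opnorm A S * A_norm A (T z)"
    using assms by (intro A_norm_le_A_opnorm)
  also have "\<dots> \<le> A_opnorm A S * (A_opnorm A T * A_norm A z)"
    using assms by (intro mult_left_mono A_norm_le_A_opnorm A_opnorm_nonneg)
  finally show "A_norm A ((S \<circ> T) z) \<le> A_opnorm A S * A_opnorm A T * A_norm A z"
    by (simp add: mult.assoc)
qed (use assms A_opnorm_nonneg in auto)

lemma A_spectral_radius_LIMSEQ:
  assumes "A_bounded S"
  shows "(\<lambda>n. root n (A_opnorm A (S ^^ n))) \<longlonglongrightarrow> A_spectral_radius A S"
proof -
  have "convergent (\<lambda>n. root n (A_opnorm A (S ^^ n)))"
  proof (rule submultiplicative_root_convergent)
    show "0 \<le> A_opnorm A (S ^^ n)" for n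
      by (intro A_opnorm_nonneg A_bounded_funpow assms)
    show "A_opnorm A (S ^^ (m + n)) \<le> A_opnorm A (S ^^ m) * A_opnorm A (S ^^ n)" for m n
      unfolding funpow_add by (intro A_opnorm_compose_le A_bounded_funpow assms)
  qed
  then show ?thesis unfolding A_spectral_radius_def by (simp add: convergent_LIMSEQ_iff)
qed

text \<open>Cauchy-Schwarz bounds \<open>(A_norm A (V x))\<^sup>2\<close> by
  \<open>A_norm A x * A_norm A (V (V x))\<close> for symmetric \<open>V\<close>; with
  \<open>V = W ^^ (2 ^ n)\<close> this doubles the exponent. The division-free form also covers
  seminorm 0.\<close>

lemma A_norm_selfadjoint_power:
  assumes sa: "\<And>x y. inner (A (W x)) y = inner (A x) (W y)"
  shows "A_norm A (W x) ^ (2 ^ n) * A_norm A x \<le> A_norm A ((W ^^ (2 ^ n)) x) * A_norm A x ^ (2 ^ n)"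
proof (induction n)
  case (Suc n)
  let ?k = "2 ^ n :: nat" and ?V = "W ^^ (2 ^ n)"
  have sak: "inner (A ((W ^^ j) x)) y = inner (A x) ((W ^^ j) y)" for j x y
    by (induction j arbitrary: x y) (simp_all add: sa funpow_swap1)
  have "(A_norm A (?V x))\<^sup>2 = inner (A x) (?V (?V x))"
    unfolding A_norm_power2 by (rule sak)
  also have "?V (?V x) = (W ^^ (2 ^ Suc n)) x"
    by (simp add: funpow_add mult_2)
  also have "inner (A x) \<dots> \<le> A_norm A x * A_norm A \<dots>"
    using cauchy_schwarz[of x "(W ^^ (2 ^ Suc n)) x"] by simp
  finally have V: "(A_norm A (?V x))\<^sup>2 \<le> A_norm A x * A_norm A ((W ^^ (2 ^ Suc n)) x)" .
  show ?case
  proof (cases "A_norm A x = 0")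
    case False
    then have pos: "0 < A_norm A x" using A_norm_nonneg[of x] by linarith
    have "(A_norm A (W x) ^ ?k * A_norm A x)\<^sup>2 \<le> (A_norm A (?V x) * A_norm A x ^ ?k)\<^sup>2"
      using Suc.IH by (intro power_mono) auto
    also have "\<dots> \<le> (A_norm A x * A_norm A ((W ^^ (2 ^ Suc n)) x)) * (A_norm A x ^ ?k)\<^sup>2"
      using V by (simp add: power_mult_distrib mult_right_mono)
    \<comment> \<open>Squaring leaves one surplus factor \<open>A_norm A x\<close> on both sides,
      set apart here for cancellation.\<close>
    finally have "A_norm A x * (A_norm A (W x) ^ (2 ^ Suc n) * A_norm A x)
        \<le> A_norm A x * (A_norm A ((W ^^ (2 ^ Suc n)) x) * A_norm A x ^ (2 ^ Suc n))"
      by (simp add: power_mult_distrib power2_eq_square mult_2 power_add ac_simps)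
    then show ?thesis using pos by simp
  qed simp
qed simp

text \<open>Powers of \<open>W\<close> are controlled in the Hilbert norm by \<open>onorm W\<close>.
  Passing from that norm to the seminorm costs only a constant \<open>c\<close>, which cannot offset
  an exponential gap between \<open>q\<close> and \<open>t\<close>.\<close>

lemma A_norm_selfadjoint_le:
  assumes W: "bounded_linear W" and sa: "\<And>x y. inner (A (W x)) y = inner (A x) (W y)"
    and pos: "0 < A_norm A x"
  shows "A_norm A (W x) \<le> onorm W * A_norm A x"
proof (rule ccontr)
  assume less: "\<not> A_norm A (W x) \<le> onorm W * A_norm A x"
  define t where "t = onorm W * A_norm A x"
  define q where "q = A_norm A (W x)"
  have lt: "t < q" using less by (simp add: t_def q_def)
  have t0: "0 \<le> t" unfolding t_def using W by (simp add: onorm_pos_le)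
  obtain M where M: "0 < M" "\<And>x. A_norm A x \<le> M * norm x" using A_norm_le_norm by blast
  define c where "c = M * norm x / A_norm A x"
  have pow: "norm ((W ^^ k) x) \<le> onorm W ^ k * norm x" for k
  proof (induction k)
    case (Suc k)
    have "norm (W ((W ^^ k) x)) \<le> onorm W * norm ((W ^^ k) x)" using onorm[OF W] .
    also have "\<dots> \<le> onorm W * (onorm W ^ k * norm x)"
      using Suc W by (intro mult_left_mono) (auto simp: onorm_pos_le)
    finally show ?case by (simp add: mult.assoc)
  qed simp
  have bound: "q ^ (2 ^ n) \<le> c * t ^ (2 ^ n)" for n
  proof -
    have "q ^ (2 ^ n) * A_norm A x \<le> A_norm A ((W ^^ (2 ^ n)) x) * A_norm A x ^ (2 ^ n)"
      unfolding q_def by (rule A_norm_selfadjoint_power[OF sa])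
    also have "\<dots> \<le> (M * (onorm W ^ (2 ^ n) * norm x)) * A_norm A x ^ (2 ^ n)"
      using M pow[of "2 ^ n"]
      by (intro mult_right_mono order_trans[OF M(2)] mult_left_mono) auto
    also have "\<dots> = (c * t ^ (2 ^ n)) * A_norm A x"
      using pos by (simp add: c_def t_def power_mult_distrib)
    finally show ?thesis using pos by (simp only: mult_le_cancel_right_pos)
  qed
  have q0: "0 < q" using lt t0 by simp
  have c0: "0 \<le> c" unfolding c_def using M pos by simp
  have "(\<lambda>k. c * (t / q) ^ k) \<longlonglongrightarrow> c * 0"
    using lt t0 q0 by (intro tendsto_intros LIMSEQ_power_zero) simp
  then have "eventually (\<lambda>k. c * (t / q) ^ k < 1) sequentially"
    by (intro order_tendstoD) auto
  then obtain N where N: "\<And>k. k \<ge> N \<Longrightarrow> c * (t / q) ^ k < 1"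
    by (auto simp: eventually_sequentially)
  \<comment> \<open>\<open>bound\<close> is available only at powers of 2, and \<open>2 ^ N\<close>
    exceeds \<open>N\<close>.\<close>
  have "c * (t / q) ^ (2 ^ N) < 1" by (intro N less_imp_le less_exp)
  then show False using bound[of N] q0 by (simp add: power_divide divide_less_eq)
qed

text \<open>The composite \<open>R \<circ> S\<close> is symmetric for the form, and
  \<open>(A_norm A (S z))\<^sup>2\<close> equals its form value at \<open>z\<close>; the previous
  estimate then bounds \<open>S\<close>.\<close>

lemma A_adjoint_imp_A_bounded:
  assumes S: "bounded_linear S" and R: "bounded_linear R"
    and adj: "\<And>x y. inner (A (S x)) y = inner (A x) (R y)"
  shows "A_bounded S"
proof -
  let ?W = "\<lambda>x. R (S x)"
  have W: "bounded_linear ?W" by (rule bounded_linear_compose[OF R S])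
  have adj': "inner (A (R x)) y = inner (A x) (S y)" for x y
    using adj[of y x] inner_sym by metis
  have "A_norm A (S z) \<le> sqrt (onorm ?W) * A_norm A z" for z
  proof -
    have "(A_norm A (S z))\<^sup>2 = inner (A z) (?W z)" unfolding A_norm_power2 by (rule adj)
    also have "\<dots> \<le> A_norm A z * A_norm A (?W z)"
      using cauchy_schwarz[of z "?W z"] by simp
    also have "\<dots> \<le> A_norm A z * (onorm ?W * A_norm A z)"
    proof (cases "A_norm A z = 0")
      case False
      then have "0 < A_norm A z" using A_norm_nonneg[of z] by linarith
      then show ?thesis
        by (intro mult_left_mono A_norm_selfadjoint_le W) (simp_all add: adj adj')
    qed simp
    also have "\<dots> = (sqrt (onorm ?W) * A_norm A z)\<^sup>2"
      using onorm_pos_le[OF W] by (simp add: power_mult_distrib power2_eq_square)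
    finally show ?thesis
      by (rule power2_le_imp_le) (simp add: onorm_pos_le[OF W])
  qed
  then show ?thesis
    unfolding A_bounded_def using S onorm_pos_le[OF W]
    by (auto intro!: exI[of _ "sqrt (onorm ?W)"] simp: bounded_linear.linear)
qed

end

text \<open>The equation defining \<open>B_A\<close> says that \<open>R\<close> is adjoint to
  \<open>S\<close> for the form of \<open>A\<close>; only its real part is taken.\<close>

lemma B_A_imp_A_bounded:
  fixes A :: "'h::chilbert_space \<Rightarrow> 'h"
  assumes A: "positive_op A" and S: "S \<in> B_A A"
  shows "positive_operator.A_bounded A S"
proof -
  interpret positive_operator A using A by unfold_locales
  obtain R where Sc: "bounded_clinear S" and Rc: "bounded_clinear R"
    and R: "A \<circ> R = cadjoint S \<circ> A"
    using S by (auto simp: B_A_def)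
  have "inner (A (S x)) y = inner (A x) (R y)" for x y
  proof -
    have "inner (A (S x)) y = inner (S x) (A y)" using inner_sym inner_commute by metis
    also have "\<dots> = inner x (cadjoint S (A y))"
      by (simp add: inner_eq_Re_cinner cadjoint_cinner[OF Sc])
    also have "\<dots> = inner x (A (R y))" using fun_cong[OF R, of y] by simp
    also have "\<dots> = inner (A x) (R y)" using inner_sym inner_commute by metis
    finally show ?thesis .
  qed
  then show ?thesis
    using Sc Rc by (intro A_adjoint_imp_A_bounded) (auto simp: bounded_clinear_def)
qed

section \<open>The spectral radius of a sum of two products\<close>

text \<open>The bound on \<open>t\<close> is the Perron root of the matrix with rows \<open>(a, b)\<close> and \<open>(c, d)\<close>.\<close>

lemma perron_supersolution:
  fixes a b c d t :: real
  assumes nonneg: "0 \<le> a" "0 \<le> b" "0 \<le> c" "0 \<le> d"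
    and t: "(a + d + sqrt ((a - d)\<^sup>2 + 4 * b * c)) / 2 < t"
  obtains u v where "0 < u" "0 < v" "a * u + b * v \<le> t * u" "c * u + d * v \<le> t * v"
proof -
  let ?s = "sqrt ((a - d)\<^sup>2 + 4 * b * c)"
  have bc: "0 \<le> b * c" using nonneg by simp
  have "\<bar>a - d\<bar> \<le> ?s" using bc by (intro real_le_rsqrt) simp
  then have ta: "0 < t - a" and td: "0 < t - d" using t by auto
  have "?s < 2 * t - a - d" using t by simp
  then have "?s\<^sup>2 < (2 * t - a - d)\<^sup>2" using bc by (intro power_strict_mono) auto
  then have "(a - d)\<^sup>2 + 4 * b * c < (2 * t - a - d)\<^sup>2" using bc by (simp add: mult.assoc)
  \<comment> \<open>The characteristic polynomial is positive at \<open>t\<close>, as \<open>(2 * t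
    - a - d)\<^sup>2 - (a - d)\<^sup>2 = 4 * (t - a) * (t - d)\<close>.\<close>
  then have det: "b * c < (t - a) * (t - d)" by (simp add: power2_eq_square algebra_simps)
  show thesis
  proof (cases "b = 0")
    case True
    \<comment> \<open>The vector \<open>(b, t - a)\<close> used below would have a zero entry; for
      this triangular matrix a multiple of \<open>t - d\<close> fits, and the 1 in
      \<open>c + 1\<close> keeps \<open>v\<close> positive.\<close>
    show thesis
    proof (rule that[of "t - d" "c + 1"])
      show "c * (t - d) + d * (c + 1) \<le> t * (c + 1)" using td by (simp add: algebra_simps)
    qed (use True nonneg ta td in \<open>auto simp: mult_right_mono\<close>)
  next
    case False
    \<comment> \<open>The first row holds with equality, and the second is
      \<open>det\<close>.\<close>
    show thesis
      by (rule that[of b "t - a"])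
        (use False nonneg ta det in \<open>auto simp: algebra_simps\<close>)
  qed
qed

context positive_operator
begin

text \<open>The vector \<open>(u, v)\<close> is a supersolution, so once the pair of seminorms lies
  below a multiple of it, each application of \<open>T\<close> scales that multiple by at most
  \<open>t\<close>.\<close>

lemma A_norm_funpow_growth:
  assumes bounded: "A_bounded E\<^sub>1" "A_bounded E\<^sub>2" "A_bounded F\<^sub>1" "A_bounded F\<^sub>2"
    and T: "T = (\<lambda>x. E\<^sub>1 (F\<^sub>1 x) + E\<^sub>2 (F\<^sub>2 x))"
    and u: "A_opnorm A (F\<^sub>1 \<circ> E\<^sub>1) * u + A_opnorm A (F\<^sub>1 \<circ> E\<^sub>2) * v \<le> t * u"
    and v: "A_opnorm A (F\<^sub>2 \<circ> E\<^sub>1) * u + A_opnorm A (F\<^sub>2 \<circ> E\<^sub>2) * v \<le> t * v"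
    and k: "0 \<le> k" "A_norm A (F\<^sub>1 z) \<le> k * u" "A_norm A (F\<^sub>2 z) \<le> k * v"
    and "0 < t"
  shows "A_norm A (F\<^sub>1 ((T ^^ n) z)) \<le> k * t ^ n * u \<and> A_norm A (F\<^sub>2 ((T ^^ n) z)) \<le> k * t ^ n * v"
proof (induction n)
  case (Suc n)
  let ?y = "(T ^^ n) z"
  \<comment> \<open>One statement for both matrix rows: \<open>F\<close> selects the row and
    \<open>w\<close> the matching entry of \<open>(u, v)\<close>.\<close>
  have step: "A_norm A (F (T ?y)) \<le> k * t ^ Suc n * w"
    if F: "A_bounded F"
      and w: "A_opnorm A (F \<circ> E\<^sub>1) * u + A_opnorm A (F \<circ> E\<^sub>2) * v \<le> t * w" for F w
  proof -
    have lin: "linear F" using F by (simp add: A_bounded_def)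
    have "A_norm A (F (T ?y)) \<le> A_norm A ((F \<circ> E\<^sub>1) (F\<^sub>1 ?y)) + A_norm A ((F \<circ> E\<^sub>2) (F\<^sub>2 ?y))"
      using A_norm_triangle by (simp add: T linear_add[OF lin])
    also have "\<dots> \<le> A_opnorm A (F \<circ> E\<^sub>1) * A_norm A (F\<^sub>1 ?y) + A_opnorm A (F \<circ> E\<^sub>2) * A_norm A (F\<^sub>2 ?y)"
      by (intro add_mono A_norm_le_A_opnorm A_bounded_compose F bounded)
    also have "\<dots> \<le> A_opnorm A (F \<circ> E\<^sub>1) * (k * t ^ n * u) + A_opnorm A (F \<circ> E\<^sub>2) * (k * t ^ n * v)"
      using Suc.IH by (intro add_mono mult_left_mono A_opnorm_nonneg A_bounded_compose F bounded) auto
    also have "\<dots> = k * t ^ n * (A_opnorm A (F \<circ> E\<^sub>1) * u + A_opnorm A (F \<circ> E\<^sub>2) * v)"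
      by (simp add: algebra_simps)
    also have "\<dots> \<le> k * t ^ n * (t * w)"
      using w k \<open>0 < t\<close> by (intro mult_left_mono) auto
    finally show ?thesis by (simp add: ac_simps)
  qed
  show ?case using step[OF bounded(3) u] step[OF bounded(4) v] by simp
qed (use k in simp)

text \<open>Only \<open>t\<close> strictly above the bound are treated: each is positive and admits
  a positive supersolution, which may fail to exist at the Perron root itself.\<close>

lemma A_spectral_radius_sum_le:
  assumes bounded: "A_bounded E\<^sub>1" "A_bounded E\<^sub>2" "A_bounded F\<^sub>1" "A_bounded F\<^sub>2"
  shows "A_spectral_radius A (\<lambda>x. E\<^sub>1 (F\<^sub>1 x) + E\<^sub>2 (F\<^sub>2 x)) \<le>
    (A_opnorm A (F\<^sub>1 \<circ> E\<^sub>1) + A_opnorm A (F\<^sub>2 \<circ> E\<^sub>2)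
      + sqrt ((A_opnorm A (F\<^sub>1 \<circ> E\<^sub>1) - A_opnorm A (F\<^sub>2 \<circ> E\<^sub>2))\<^sup>2
        + 4 * A_opnorm A (F\<^sub>1 \<circ> E\<^sub>2) * A_opnorm A (F\<^sub>2 \<circ> E\<^sub>1))) / 2"
proof (rule dense_ge)
  define T where "T = (\<lambda>x. E\<^sub>1 (F\<^sub>1 x) + E\<^sub>2 (F\<^sub>2 x))"
  have T: "A_bounded T"
    using A_bounded_add[OF A_bounded_compose A_bounded_compose, OF bounded(1,3,2,4)]
    by (simp add: T_def)
  fix t
  assume t: "(A_opnorm A (F\<^sub>1 \<circ> E\<^sub>1) + A_opnorm A (F\<^sub>2 \<circ> E\<^sub>2)
      + sqrt ((A_opnorm A (F\<^sub>1 \<circ> E\<^sub>1) - A_opnorm A (F\<^sub>2 \<circ> E\<^sub>2))\<^sup>2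
        + 4 * A_opnorm A (F\<^sub>1 \<circ> E\<^sub>2) * A_opnorm A (F\<^sub>2 \<circ> E\<^sub>1))) / 2 < t"
  have nn: "0 \<le> A_opnorm A (F\<^sub>1 \<circ> E\<^sub>1)" "0 \<le> A_opnorm A (F\<^sub>1 \<circ> E\<^sub>2)"
    "0 \<le> A_opnorm A (F\<^sub>2 \<circ> E\<^sub>1)" "0 \<le> A_opnorm A (F\<^sub>2 \<circ> E\<^sub>2)"
    by (intro A_opnorm_nonneg A_bounded_compose bounded)+
  have nnE: "0 \<le> A_opnorm A E\<^sub>1" "0 \<le> A_opnorm A E\<^sub>2" "0 \<le> A_opnorm A F\<^sub>1" "0 \<le> A_opnorm A F\<^sub>2"
    by (intro A_opnorm_nonneg bounded)+
  have "0 \<le> (A_opnorm A (F\<^sub>1 \<circ> E\<^sub>1) + A_opnorm A (F\<^sub>2 \<circ> E\<^sub>2)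
      + sqrt ((A_opnorm A (F\<^sub>1 \<circ> E\<^sub>1) - A_opnorm A (F\<^sub>2 \<circ> E\<^sub>2))\<^sup>2
        + 4 * A_opnorm A (F\<^sub>1 \<circ> E\<^sub>2) * A_opnorm A (F\<^sub>2 \<circ> E\<^sub>1))) / 2"
    using nn by (intro divide_nonneg_pos add_nonneg_nonneg) auto
  then have t0: "0 < t" using t by (rule le_less_trans)
  obtain u v where uv: "0 < u" "0 < v"
    and u: "A_opnorm A (F\<^sub>1 \<circ> E\<^sub>1) * u + A_opnorm A (F\<^sub>1 \<circ> E\<^sub>2) * v \<le> t * u"
    and v: "A_opnorm A (F\<^sub>2 \<circ> E\<^sub>1) * u + A_opnorm A (F\<^sub>2 \<circ> E\<^sub>2) * v \<le> t * v"
    using perron_supersolution[OF nn t] by blast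
  \<comment> \<open>\<open>c\<close> places the initial pair below a multiple of
    \<open>(u, v)\<close>; \<open>e\<close> bounds the return from the pair to a vector through
    \<open>E\<^sub>1\<close> and \<open>E\<^sub>2\<close>.\<close>
  define c where "c = A_opnorm A F\<^sub>1 / u + A_opnorm A F\<^sub>2 / v"
  define e where "e = A_opnorm A E\<^sub>1 * u + A_opnorm A E\<^sub>2 * v"
  have c0: "0 \<le> c" and e0: "0 \<le> e" using nnE uv by (auto simp: c_def e_def)
  \<comment> \<open>The 1 covers \<open>n = 0\<close>; dividing by \<open>t\<close> supplies the
    missing power, since \<open>T ^^ n\<close> is recovered from the pair at
    \<open>n - 1\<close>.\<close>
  define K where "K = 1 + e * c / t"
  have K: "1 \<le> K" using c0 e0 t0 by (simp add: K_def)
  have "A_opnorm A (T ^^ n) \<le> K * t ^ n" for n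
  proof (rule A_opnorm_le)
    fix z
    let ?k = "c * A_norm A z"
    have "A_opnorm A F\<^sub>1 \<le> c * u" "A_opnorm A F\<^sub>2 \<le> c * v"
      using uv nnE by (auto simp: c_def distrib_right)
    then have F: "A_norm A (F\<^sub>1 z) \<le> ?k * u" "A_norm A (F\<^sub>2 z) \<le> ?k * v"
      using order_trans[OF A_norm_le_A_opnorm[OF bounded(3)] mult_right_mono[of _ "c * u"]]
        order_trans[OF A_norm_le_A_opnorm[OF bounded(4)] mult_right_mono[of _ "c * v"]]
      by (auto simp: ac_simps)
    show "A_norm A ((T ^^ n) z) \<le> K * t ^ n * A_norm A z"
    proof (cases n)
      case 0
      then show ?thesis using K mult_right_mono[of 1 K "A_norm A z"] by simp
    next
      case (Suc m)
      let ?y = "(T ^^ m) z"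
      have growth: "A_norm A (F\<^sub>1 ?y) \<le> ?k * t ^ m * u" "A_norm A (F\<^sub>2 ?y) \<le> ?k * t ^ m * v"
        using A_norm_funpow_growth[OF bounded T_def u v _ F t0] c0 by auto
      have "A_norm A (T ?y) \<le> A_norm A (E\<^sub>1 (F\<^sub>1 ?y)) + A_norm A (E\<^sub>2 (F\<^sub>2 ?y))"
        unfolding T_def by (rule A_norm_triangle)
      also have "\<dots> \<le> A_opnorm A E\<^sub>1 * A_norm A (F\<^sub>1 ?y) + A_opnorm A E\<^sub>2 * A_norm A (F\<^sub>2 ?y)"
        by (intro add_mono A_norm_le_A_opnorm bounded)
      also have "\<dots> \<le> A_opnorm A E\<^sub>1 * (?k * t ^ m * u) + A_opnorm A E\<^sub>2 * (?k * t ^ m * v)"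
        by (intro add_mono mult_left_mono growth nnE)
      also have "\<dots> = e * c / t * t ^ n * A_norm A z"
        using t0 by (simp add: e_def Suc field_simps)
      also have "\<dots> \<le> K * t ^ n * A_norm A z"
        using t0 by (intro mult_right_mono) (auto simp: K_def)
      finally show ?thesis by (simp add: Suc)
    qed
  qed (use K t0 in simp)
  then show "A_spectral_radius A (\<lambda>x. E\<^sub>1 (F\<^sub>1 x) + E\<^sub>2 (F\<^sub>2 x)) \<le> t"
    using LIMSEQ_root_le[OF A_spectral_radius_LIMSEQ[OF T], of K t] K t0 by (simp add: T_def)
qed

end

theorem theorem27:
  fixes A C\<^sub>1 C\<^sub>2 D\<^sub>1 D\<^sub>2 X\<^sub>1 X\<^sub>2 :: "'h::chilbert_space \<Rightarrow> 'h"
  assumes "positive_op A"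
    and "C\<^sub>1 \<in> B_A A" and "C\<^sub>2 \<in> B_A A"
    and "D\<^sub>1 \<in> B_A A" and "D\<^sub>2 \<in> B_A A"
    and "X\<^sub>1 \<in> B_A A" and "X\<^sub>2 \<in> B_A A"
  shows
    "let \<alpha>\<^sub>1 = (A_opnorm A (X\<^sub>1 \<circ> D\<^sub>1 \<circ> C\<^sub>1) + A_opnorm A (D\<^sub>2 \<circ> C\<^sub>2 \<circ> X\<^sub>2)
            + sqrt ((A_opnorm A (X\<^sub>1 \<circ> D\<^sub>1 \<circ> C\<^sub>1) - A_opnorm A (D\<^sub>2 \<circ> C\<^sub>2 \<circ> X\<^sub>2))\<^sup>2
              + 4 * A_opnorm A (X\<^sub>1 \<circ> D\<^sub>1 \<circ> C\<^sub>2 \<circ> X\<^sub>2) * A_opnorm A (D\<^sub>2 \<circ> C\<^sub>1))) / 2;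
         \<alpha>\<^sub>2 = (A_opnorm A (D\<^sub>1 \<circ> C\<^sub>1 \<circ> X\<^sub>1) + A_opnorm A (X\<^sub>2 \<circ> D\<^sub>2 \<circ> C\<^sub>2)
            + sqrt ((A_opnorm A (D\<^sub>1 \<circ> C\<^sub>1 \<circ> X\<^sub>1) - A_opnorm A (X\<^sub>2 \<circ> D\<^sub>2 \<circ> C\<^sub>2))\<^sup>2
              + 4 * A_opnorm A (X\<^sub>2 \<circ> D\<^sub>2 \<circ> C\<^sub>1 \<circ> X\<^sub>1) * A_opnorm A (D\<^sub>1 \<circ> C\<^sub>2))) / 2
     in A_spectral_radius A (\<lambda>x. (C\<^sub>1 \<circ> X\<^sub>1 \<circ> D\<^sub>1) x + (C\<^sub>2 \<circ> X\<^sub>2 \<circ> D\<^sub>2) x) \<le> min \<alpha>\<^sub>1 \<alpha>\<^sub>2"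
proof -
  interpret positive_operator A using assms(1) by unfold_locales
  note bounded = assms(2-)[THEN B_A_imp_A_bounded[OF assms(1)]]
  \<comment> \<open>Cut the summands as \<open>C\<^sub>1\<close> times
    \<open>X\<^sub>1 \<circ> D\<^sub>1\<close> and \<open>C\<^sub>2 \<circ> X\<^sub>2\<close> times
    \<open>D\<^sub>2\<close>.\<close>
  have "A_spectral_radius A (\<lambda>x. (C\<^sub>1 \<circ> X\<^sub>1 \<circ> D\<^sub>1) x + (C\<^sub>2 \<circ> X\<^sub>2 \<circ> D\<^sub>2) x) \<le>
      (A_opnorm A (X\<^sub>1 \<circ> D\<^sub>1 \<circ> C\<^sub>1) + A_opnorm A (D\<^sub>2 \<circ> C\<^sub>2 \<circ> X\<^sub>2)
        + sqrt ((A_opnorm A (X\<^sub>1 \<circ> D\<^sub>1 \<circ> C\<^sub>1) - A_opnorm A (D\<^sub>2 \<circ> C\<^sub>2 \<circ> X\<^sub>2))\<^sup>2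
          + 4 * A_opnorm A (X\<^sub>1 \<circ> D\<^sub>1 \<circ> C\<^sub>2 \<circ> X\<^sub>2) * A_opnorm A (D\<^sub>2 \<circ> C\<^sub>1))) / 2"
    using A_spectral_radius_sum_le[of C\<^sub>1 "C\<^sub>2 \<circ> X\<^sub>2" "X\<^sub>1 \<circ> D\<^sub>1" D\<^sub>2]
    by (simp add: bounded A_bounded_compose comp_assoc)
  \<comment> \<open>The opposite cuts, \<open>C\<^sub>1 \<circ> X\<^sub>1\<close> times
    \<open>D\<^sub>1\<close> and \<open>C\<^sub>2\<close> times
    \<open>X\<^sub>2 \<circ> D\<^sub>2\<close>, produce the off-diagonal factors in reverse
    order.\<close>
  moreover have "A_spectral_radius A (\<lambda>x. (C\<^sub>1 \<circ> X\<^sub>1 \<circ> D\<^sub>1) x + (C\<^sub>2 \<circ> X\<^sub>2 \<circ> D\<^sub>2) x) \<le>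
      (A_opnorm A (D\<^sub>1 \<circ> C\<^sub>1 \<circ> X\<^sub>1) + A_opnorm A (X\<^sub>2 \<circ> D\<^sub>2 \<circ> C\<^sub>2)
        + sqrt ((A_opnorm A (D\<^sub>1 \<circ> C\<^sub>1 \<circ> X\<^sub>1) - A_opnorm A (X\<^sub>2 \<circ> D\<^sub>2 \<circ> C\<^sub>2))\<^sup>2
          + 4 * A_opnorm A (X\<^sub>2 \<circ> D\<^sub>2 \<circ> C\<^sub>1 \<circ> X\<^sub>1) * A_opnorm A (D\<^sub>1 \<circ> C\<^sub>2))) / 2"
    using A_spectral_radius_sum_le[of "C\<^sub>1 \<circ> X\<^sub>1" C\<^sub>2 D\<^sub>1 "X\<^sub>2 \<circ> D\<^sub>2"]
    by (simp add: bounded A_bounded_compose comp_assoc mult.assoc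
        mult.commute[of "A_opnorm A (D\<^sub>1 \<circ> C\<^sub>2)"])
  ultimately show ?thesis unfolding Let_def by (rule min.boundedI)
qed

end
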